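(* Let $1\le q<\infty$, let $L:L^q(\mathcal I^n,\mu_p)\to L^q(\mathcal I^n,\mu_p)$ be a bounded affine map (not necessarily linear), and let $\alpha\in L^\infty(\mathcal I^n,\mu_p)$ with $\|\alpha\|_\infty<1$. Then the fractal operator $\mathcal F^\alpha_{\Delta,L}:L^q(\mathcal I^n,\mu_p)\to L^q(\mathcal I^n,\mu_p)$, $f\mapsto f^\alpha$, is relatively Lipschitz with respect to $L$.
   Context: Let $n\ge 2$ and, for each $k\in\{1,\dots,n\}$, let $y_{k,0}<y_{k,1}<\cdots<y_{k,N_k}$ be real numbers; $\Delta$ denotes the resulting net. Put $I_k=[y_{k,0},y_{k,N_k}]$, $I_{k,j}=[y_{k,j-1},y_{k,j}]$ for $1\le j\le N_k$, and $\mathcal I^n=I_1\times\cdots\times I_n$. For each $k$ and $1\le j\le N_k$ let $v_{k,j}:I_k\to I_{k,j}$ be a homeomorphism with $|v_{k,j}(z)-v_{k,j}(z_* )|\le\gamma_{k,j}|z-z_*|$ for all $z,z_*\in I_k$, where $0<\gamma_{k,j}<1$, such that $v_{k,j}(y_{k,0})=y_{k,j-1}$, $v_{k,j}(y_{k,N_k})=y_{k,j}$ if $j$ is odd, and $v_{k,j}(y_{k,0})=y_{k,j}$, $v_{k,j}(y_{k,N_k})=y_{k,j-1}$ if $j$ is even. Let $J=\prod_{k=1}^n\{1,\dots,N_k\}$. For $j=(j_1,\dots,j_n)\in J$ put $C_j=\prod_{k=1}^n I_{k,j_k}$ and $\Theta_j:\mathcal I^n\to C_j$, $\Theta_j(y_1,\dots,y_n)=(v_{1,j_1}(y_1),\dots,v_{n,j_n}(y_n))$.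 Let $p=(p_j)_{j\in J}$ be a probability vector with all $p_j>0$, and let $\mu_p$ be the unique Borel probability measure on $\mathcal I^n$ with $\mu_p(B)=\sum_{j\in J}p_j\,\mu_p(\Theta_j^{-1}(B))$ for all Borel $B\subseteq\mathcal I^n$ (here $\Theta_j^{-1}(B)$ is the preimage). $L^q(\mathcal I^n,\mu_p)$ is the usual space of real-valued functions with norm $\|\cdot\|_q$, and $\|\cdot\|_\infty$ is the $\mu_p$-essential supremum norm. For $f\in L^q(\mathcal I^n,\mu_p)$, the $\alpha$-fractal function $f^\alpha$ is the unique element of $L^q(\mathcal I^n,\mu_p)$ satisfying, for every $j\in J$ and $\mu_p$-a.e. $y\in C_j$, $$f^\alpha(y)=f(y)+\alpha(y)\bigl(f^\alpha(\Theta_j^{-1}(y))-(Lf)(\Theta_j^{-1}(y))\bigr).$$ The fractal operator is $\mathcal F^\alpha_{\Delta,L}(f)=f^\alpha$. A map $A:X\to X$ on a normed space $X$ is relatively Lipschitz with respect to a map $B:X\to X$ if there are constants $M_1,M_2\ge0$ such that $\|A(f_1)-A(f_2)\|\le M_1\|f_1-f_2\|+M_2\|B(f_1)-B(f_2)\|$ for all $f_1,f_2\in X$. A map is bounded if it sends bounded sets to bounded sets. *)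

theory Defs
  imports "HOL-Probability.Probability"
begin

subsection \<open>The spaces $L^q$ and $L^\infty$\<close>

text \<open>Elements of \<open>Lq M q\<close> are genuine equivalence classes modulo equality almost everywhere.
  The functions are total on the type, but since measurability, integrals and \<open>AE x in M\<close> only see
  \<open>space M\<close>, functions that differ only outside \<open>space M\<close> lie in the same class.\<close>

definition Lq_funs :: "'a measure \<Rightarrow> real \<Rightarrow> ('a \<Rightarrow> real) set" where
  "Lq_funs M q = {f \<in> borel_measurable M. integrable M (\<lambda>x. \<bar>f x\<bar> powr q)}"

definition Lq_rel :: "'a measure \<Rightarrow> real \<Rightarrow> (('a \<Rightarrow> real) \<times> ('a \<Rightarrow> real)) set" where
  "Lq_rel M q = {(f, g). f \<in> Lq_funs M q \<and> g \<in> Lq_funs M q \<and> (AE x in M. f x = g x)}"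

definition Lq :: "'a measure \<Rightarrow> real \<Rightarrow> ('a \<Rightarrow> real) set set" where
  "Lq M q = Lq_funs M q // Lq_rel M q"

text \<open>The common value of the seminorm on the representatives of a class;
  cf.\ \<open>Lq_norm_class\<close> below.\<close>

definition Lq_norm :: "'a measure \<Rightarrow> real \<Rightarrow> ('a \<Rightarrow> real) set \<Rightarrow> real" where
  "Lq_norm M q X = the_elem ((\<lambda>f. (\<integral>x. \<bar>f x\<bar> powr q \<partial>M) powr (1 / q)) ` X)"

text \<open>The linear combination $aX + bY$ of two classes; cf.\ \<open>Lq_comb_class\<close> below.\<close>

definition Lq_comb ::
  "'a measure \<Rightarrow> real \<Rightarrow> real \<Rightarrow> ('a \<Rightarrow> real) set \<Rightarrow> real \<Rightarrow> ('a \<Rightarrow> real) set \<Rightarrow> ('a \<Rightarrow> real) set"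
  where
  "Lq_comb M q a X b Y = (\<Union>f\<in>X. \<Union>g\<in>Y. Lq_rel M q `` {\<lambda>x. a * f x + b * g x})"

abbreviation Lq_dist :: "'a measure \<Rightarrow> real \<Rightarrow> ('a \<Rightarrow> real) set \<Rightarrow> ('a \<Rightarrow> real) set \<Rightarrow> real" where
  "Lq_dist M q X Y \<equiv> Lq_norm M q (Lq_comb M q 1 X (-1) Y)"

definition Linf_norm :: "'a measure \<Rightarrow> ('a \<Rightarrow> real) \<Rightarrow> ereal" where
  "Linf_norm M g = esssup M (\<lambda>x. ereal \<bar>g x\<bar>)"

text \<open>Here functions, not classes: everything below depends on the function
  only up to equality almost everywhere.\<close>

definition Linf_funs :: "'a measure \<Rightarrow> ('a \<Rightarrow> real) set" where
  "Linf_funs M = {g \<in> borel_measurable M. Linf_norm M g < \<infinity>}"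

lemma equiv_Lq_rel: "equiv (Lq_funs M q) (Lq_rel M q)"
proof (rule equivI)
  show "Lq_rel M q \<subseteq> Lq_funs M q \<times> Lq_funs M q"
    by (auto simp: Lq_rel_def)
  show "refl_on (Lq_funs M q) (Lq_rel M q)"
    by (auto simp: refl_on_def Lq_rel_def)
  show "sym (Lq_rel M q)"
    by (auto simp: sym_def Lq_rel_def elim: AE_mp)
  show "trans (Lq_rel M q)"
  proof (rule transI)
    fix f g h assume "(f, g) \<in> Lq_rel M q" "(g, h) \<in> Lq_rel M q"
    then show "(f, h) \<in> Lq_rel M q"
      unfolding Lq_rel_def by (auto elim: AE_mp)
  qed
qed

lemma Lq_norm_class:
  assumes "f \<in> Lq_funs M q"
  shows "Lq_norm M q (Lq_rel M q `` {f}) = (\<integral>x. \<bar>f x\<bar> powr q \<partial>M) powr (1 / q)"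
proof -
  let ?N = "\<lambda>f. (\<integral>x. \<bar>f x\<bar> powr q \<partial>M) powr (1 / q)"
  have "?N g = ?N f" if "g \<in> Lq_rel M q `` {f}" for g
  proof -
    have meas: "f \<in> borel_measurable M" "g \<in> borel_measurable M" and ae: "AE x in M. f x = g x"
      using that by (auto simp: Lq_rel_def Lq_funs_def)
    have "(\<integral>x. \<bar>g x\<bar> powr q \<partial>M) = (\<integral>x. \<bar>f x\<bar> powr q \<partial>M)"
      by (rule integral_cong_AE) (use meas ae in \<open>auto elim: AE_mp\<close>)
    then show ?thesis by simp
  qed
  moreover have "f \<in> Lq_rel M q `` {f}"
    using assms by (auto simp: Lq_rel_def)
  ultimately have "?N ` (Lq_rel M q `` {f}) = {?N f}" by blast
  then show ?thesis unfolding Lq_norm_def by simp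
qed

lemma Lq_funs_comb:
  assumes "1 \<le> q" "f \<in> Lq_funs M q" "g \<in> Lq_funs M q"
  shows "(\<lambda>x. a * f x + b * g x) \<in> Lq_funs M q"
proof -
  have meas [measurable]: "f \<in> borel_measurable M" "g \<in> borel_measurable M"
    and int: "integrable M (\<lambda>x. \<bar>f x\<bar> powr q)" "integrable M (\<lambda>x. \<bar>g x\<bar> powr q)"
    using assms by (auto simp: Lq_funs_def)
  have bound: "\<bar>a * s + b * t\<bar> powr q
      \<le> (2 * \<bar>a\<bar>) powr q * \<bar>s\<bar> powr q + (2 * \<bar>b\<bar>) powr q * \<bar>t\<bar> powr q" for s t :: real
  proof -
    have "\<bar>a * s + b * t\<bar> \<le> max (2 * \<bar>a\<bar> * \<bar>s\<bar>) (2 * \<bar>b\<bar> * \<bar>t\<bar>)"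
      using abs_triangle_ineq[of "a * s" "b * t"] by (simp add: abs_mult max_def)
    then have "\<bar>a * s + b * t\<bar> powr q \<le> (max (2 * \<bar>a\<bar> * \<bar>s\<bar>) (2 * \<bar>b\<bar> * \<bar>t\<bar>)) powr q"
      using assms(1) by (intro powr_mono2) auto
    also have "\<dots> \<le> (2 * \<bar>a\<bar> * \<bar>s\<bar>) powr q + (2 * \<bar>b\<bar> * \<bar>t\<bar>) powr q"
      by (auto simp: max_def)
    finally show ?thesis by (simp add: powr_mult)
  qed
  have "integrable M (\<lambda>x. \<bar>a * f x + b * g x\<bar> powr q)"
  proof (rule Bochner_Integration.integrable_bound)
    show "integrable M (\<lambda>x. (2 * \<bar>a\<bar>) powr q * \<bar>f x\<bar> powr q + (2 * \<bar>b\<bar>) powr q * \<bar>g x\<bar> powr q)"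
      using int by auto
  qed (use bound in auto)
  then show ?thesis by (auto simp: Lq_funs_def)
qed

lemma Lq_comb_class:
  assumes "1 \<le> q" "f \<in> Lq_funs M q" "g \<in> Lq_funs M q"
  shows "Lq_comb M q a (Lq_rel M q `` {f}) b (Lq_rel M q `` {g})
    = Lq_rel M q `` {\<lambda>x. a * f x + b * g x}"
proof -
  have "Lq_rel M q `` {\<lambda>x. a * f' x + b * g' x} = Lq_rel M q `` {\<lambda>x. a * f x + b * g x}"
    if "f' \<in> Lq_rel M q `` {f}" "g' \<in> Lq_rel M q `` {g}" for f' g'
  proof (rule equiv_class_eq[OF equiv_Lq_rel])
    have fg': "f' \<in> Lq_funs M q" "g' \<in> Lq_funs M q"
      and "AE x in M. f x = f' x" "AE x in M. g x = g' x"
      using that by (auto simp: Lq_rel_def)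
    then have "AE x in M. a * f' x + b * g' x = a * f x + b * g x"
      by (auto elim: AE_mp)
    then show "(\<lambda>x. a * f' x + b * g' x, \<lambda>x. a * f x + b * g x) \<in> Lq_rel M q"
      using Lq_funs_comb[OF assms(1) fg'] Lq_funs_comb[OF assms] by (auto simp: Lq_rel_def)
  qed
  moreover have "f \<in> Lq_rel M q `` {f}" "g \<in> Lq_rel M q `` {g}"
    using assms by (auto simp: Lq_rel_def)
  ultimately show ?thesis unfolding Lq_comb_def by blast
qed


subsection \<open>Maps on $L^q$\<close>

definition Lq_affine ::
  "'a measure \<Rightarrow> real \<Rightarrow> (('a \<Rightarrow> real) set \<Rightarrow> ('a \<Rightarrow> real) set) \<Rightarrow> bool" where
  "Lq_affine M q A \<longleftrightarrow> (\<forall>X\<in>Lq M q. \<forall>Y\<in>Lq M q. \<forall>t.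
     A (Lq_comb M q (1 - t) X t Y) = Lq_comb M q (1 - t) (A X) t (A Y))"

definition Lq_bounded_map ::
  "'a measure \<Rightarrow> real \<Rightarrow> (('a \<Rightarrow> real) set \<Rightarrow> ('a \<Rightarrow> real) set) \<Rightarrow> bool" where
  "Lq_bounded_map M q A \<longleftrightarrow> (\<forall>S\<subseteq>Lq M q.
     bdd_above (Lq_norm M q ` S) \<longrightarrow> bdd_above (Lq_norm M q ` A ` S))"

definition Lq_relatively_Lipschitz ::
  "'a measure \<Rightarrow> real \<Rightarrow> (('a \<Rightarrow> real) set \<Rightarrow> ('a \<Rightarrow> real) set)
    \<Rightarrow> (('a \<Rightarrow> real) set \<Rightarrow> ('a \<Rightarrow> real) set) \<Rightarrow> bool" where
  "Lq_relatively_Lipschitz M q A B \<longleftrightarrow>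
     A \<in> Lq M q \<rightarrow> Lq M q \<and> B \<in> Lq M q \<rightarrow> Lq M q \<and>
     (\<exists>M1 M2. 0 \<le> M1 \<and> 0 \<le> M2 \<and>
       (\<forall>X\<in>Lq M q. \<forall>Y\<in>Lq M q.
         Lq_dist M q (A X) (A Y) \<le> M1 * Lq_dist M q X Y + M2 * Lq_dist M q (B X) (B Y)))"


subsection \<open>The net and its cells\<close>

text \<open>Coordinates are indexed by a finite type \<open>'n\<close>. For \<open>k :: 'n\<close> the knots are
  \<open>y k 0 < \<dots> < y k (N k)\<close>; values \<open>y k i\<close> with \<open>i > N k\<close> are never used.\<close>

definition axis_interval :: "('n \<Rightarrow> nat) \<Rightarrow> ('n \<Rightarrow> nat \<Rightarrow> real) \<Rightarrow> 'n \<Rightarrow> real set" where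
  "axis_interval N y k = {y k 0 .. y k (N k)}"

definition axis_subinterval :: "('n \<Rightarrow> nat \<Rightarrow> real) \<Rightarrow> 'n \<Rightarrow> nat \<Rightarrow> real set" where
  "axis_subinterval y k i = {y k (i - 1) .. y k i}"

definition net_box :: "('n::finite \<Rightarrow> nat) \<Rightarrow> ('n \<Rightarrow> nat \<Rightarrow> real) \<Rightarrow> (real ^ 'n) set" where
  "net_box N y = {x. \<forall>k. x $ k \<in> axis_interval N y k}"

definition multi_indices :: "('n::finite \<Rightarrow> nat) \<Rightarrow> ('n \<Rightarrow> nat) set" where
  "multi_indices N = {j. \<forall>k. j k \<in> {1..N k}}"

definition cell :: "('n::finite \<Rightarrow> nat \<Rightarrow> real) \<Rightarrow> ('n \<Rightarrow> nat) \<Rightarrow> (real ^ 'n) set" where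
  "cell y j = {x. \<forall>k. x $ k \<in> axis_subinterval y k (j k)}"

definition Theta ::
  "('n::finite \<Rightarrow> nat \<Rightarrow> real \<Rightarrow> real) \<Rightarrow> ('n \<Rightarrow> nat) \<Rightarrow> real ^ 'n \<Rightarrow> real ^ 'n" where
  "Theta v j x = (\<chi> k. v k (j k) (x $ k))"

abbreviation Theta_inv ::
  "('n::finite \<Rightarrow> nat) \<Rightarrow> ('n \<Rightarrow> nat \<Rightarrow> real) \<Rightarrow> ('n \<Rightarrow> nat \<Rightarrow> real \<Rightarrow> real)
    \<Rightarrow> ('n \<Rightarrow> nat) \<Rightarrow> real ^ 'n \<Rightarrow> real ^ 'n" where
  "Theta_inv N y v j \<equiv> inv_into (net_box N y) (Theta v j)"

definition invariant_prob ::
  "('n::finite \<Rightarrow> nat) \<Rightarrow> ('n \<Rightarrow> nat \<Rightarrow> real) \<Rightarrow> ('n \<Rightarrow> nat \<Rightarrow> real \<Rightarrow> real)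
    \<Rightarrow> (('n \<Rightarrow> nat) \<Rightarrow> real) \<Rightarrow> (real ^ 'n) measure \<Rightarrow> bool" where
  "invariant_prob N y v p \<mu> \<longleftrightarrow>
     prob_space \<mu> \<and> space \<mu> = net_box N y \<and> sets \<mu> = sets (restrict_space borel (net_box N y)) \<and>
     (\<forall>B\<in>sets \<mu>. measure \<mu> B =
        (\<Sum>j\<in>multi_indices N. p j * measure \<mu> (Theta v j -` B \<inter> net_box N y)))"


subsection \<open>The fractal operator\<close>

text \<open>\<open>X\<close>, \<open>LX\<close> and \<open>G\<close> are the classes of $f$, $Lf$ and the candidate for $f^\alpha$. The almost
  everywhere equation is required of all representatives; the maps \<open>Theta v j\<close> are nonsingular
  with respect to the invariant measure, so the choice of representatives is immaterial.\<close>

definition self_referential ::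
  "('n::finite \<Rightarrow> nat) \<Rightarrow> ('n \<Rightarrow> nat \<Rightarrow> real) \<Rightarrow> ('n \<Rightarrow> nat \<Rightarrow> real \<Rightarrow> real)
    \<Rightarrow> (real ^ 'n) measure \<Rightarrow> (real ^ 'n \<Rightarrow> real)
    \<Rightarrow> (real ^ 'n \<Rightarrow> real) set \<Rightarrow> (real ^ 'n \<Rightarrow> real) set \<Rightarrow> (real ^ 'n \<Rightarrow> real) set \<Rightarrow> bool" where
  "self_referential N y v \<mu> \<alpha> X LX G \<longleftrightarrow>
     (\<forall>f\<in>X. \<forall>l\<in>LX. \<forall>g\<in>G. \<forall>j\<in>multi_indices N.
        AE x in \<mu>. x \<in> cell y j \<longrightarrow>
          g x = f x + \<alpha> x * (g (Theta_inv N y v j x) - l (Theta_inv N y v j x)))"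

definition fractal_operator ::
  "('n::finite \<Rightarrow> nat) \<Rightarrow> ('n \<Rightarrow> nat \<Rightarrow> real) \<Rightarrow> ('n \<Rightarrow> nat \<Rightarrow> real \<Rightarrow> real)
    \<Rightarrow> (real ^ 'n) measure \<Rightarrow> real \<Rightarrow> (real ^ 'n \<Rightarrow> real)
    \<Rightarrow> ((real ^ 'n \<Rightarrow> real) set \<Rightarrow> (real ^ 'n \<Rightarrow> real) set)
    \<Rightarrow> (real ^ 'n \<Rightarrow> real) set \<Rightarrow> (real ^ 'n \<Rightarrow> real) set" where
  "fractal_operator N y v \<mu> q \<alpha> L X =
     (THE G. G \<in> Lq \<mu> q \<and> self_referential N y v \<mu> \<alpha> X (L X) G)"

end

theory Submission
  imports Defs
begin

text \<open>The inverses of the maps \<open>Theta v j\<close> agree where cells overlap, because neighbouring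
  one-dimensional maps have opposite orientation. They therefore glue to a single map $T$ of the box
  with $T \circ \Theta_j = \mathrm{id}$ for all $j$, and the self-similarity of $\mu_p$ says that $T$
  preserves $\mu_p$. The defining equation becomes $g = f + \alpha\,(g - Lf) \circ T$ almost everywhere,
  in which $g \mapsto \alpha\,(g \circ T)$ contracts $L^q$ by the factor $c < 1$ that bounds $|\alpha|$.
  Its solution is the Neumann series $\sum_n \bigl(\prod_{i<n} \alpha \circ T^i\bigr)\, u \circ T^n$ with
  $u = f - \alpha\,(Lf \circ T)$, and subtracting the equations of two functions gives uniqueness
  and the relative Lipschitz estimate.\<close>

section \<open>Powers of subconvex combinations\<close>

text \<open>Jensen's inequality for the convex power, applied after dividing the weights by their
  sum \<open>s\<close>. Undoing the normalisation costs a factor \<open>s powr (q - 1)\<close>,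
  which is at most 1 because \<open>s \<le> 1\<close> and \<open>q \<ge> 1\<close>.\<close>

lemma powr_sum_le:
  fixes w b :: "'i \<Rightarrow> real"
  assumes "finite A" "1 \<le> q" "\<And>i. i \<in> A \<Longrightarrow> 0 \<le> w i" "\<And>i. i \<in> A \<Longrightarrow> 0 \<le> b i"
    and "sum w A \<le> 1"
  shows "(\<Sum>i\<in>A. w i * b i) powr q \<le> (\<Sum>i\<in>A. w i * b i powr q)"
proof -
  \<comment> \<open>Terms with vanishing weight or value contribute 0 to both sides. On the
    remaining index set all arguments of the power are positive, and if it is nonempty then
    \<open>s > 0\<close>, so the weights can be normalised.\<close>
  define B where "B = {i \<in> A. 0 < w i \<and> 0 < b i}"
  define s where "s = sum w B"
  have B: "finite B" "B \<subseteq> A" using assms(1) by (auto simp: B_def)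
  have zero: "w i * b i = 0 \<and> w i * b i powr q = 0" if "i \<in> A - B" for i
    using that assms(3,4)[of i] by (force simp: B_def)
  have eq1: "(\<Sum>i\<in>A. w i * b i) = (\<Sum>i\<in>B. w i * b i)"
    using zero B assms(1) by (intro sum.mono_neutral_right) auto
  have eq2: "(\<Sum>i\<in>A. w i * b i powr q) = (\<Sum>i\<in>B. w i * b i powr q)"
    using zero B assms(1) by (intro sum.mono_neutral_right) auto
  show ?thesis
  proof (cases "B = {}")
    case True
    then show ?thesis by (simp add: eq1 eq2)
  next
    case False
    have s0: "0 < s" unfolding s_def using False B by (intro sum_pos) (auto simp: B_def)
    have "s \<le> sum w A" unfolding s_def using assms(1,3) B by (intro sum_mono2) auto
    then have s1: "s \<le> 1" using assms(5) by simp
    have conv: "(\<Sum>i\<in>B. (w i / s) *\<^sub>R b i) powr q \<le> (\<Sum>i\<in>B. (w i / s) * b i powr q)"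
      using s0 B False
      by (intro convex_on_sum[OF _ _ powr_convex[OF assms(2)]])
        (auto simp: B_def s_def simp flip: sum_divide_distrib)
    have nn: "0 \<le> (\<Sum>i\<in>B. w i * b i)" by (intro sum_nonneg) (auto simp: B_def)
    have nn': "0 \<le> (\<Sum>i\<in>B. w i * b i powr q)" by (intro sum_nonneg) (auto simp: B_def)
    have "((\<Sum>i\<in>B. w i * b i) / s) powr q \<le> (\<Sum>i\<in>B. w i * b i powr q) / s"
      using conv by (simp add: sum_divide_distrib)
    then have "(\<Sum>i\<in>B. w i * b i) powr q / s powr q \<le> (\<Sum>i\<in>B. w i * b i powr q) / s"
      using nn s0 by (simp add: powr_divide)
    then have "(\<Sum>i\<in>B. w i * b i) powr q \<le> s powr q * ((\<Sum>i\<in>B. w i * b i powr q) / s)"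
      using s0 by (simp add: field_simps)
    also have "\<dots> = s powr (q - 1) * (\<Sum>i\<in>B. w i * b i powr q)"
      using s0 by (simp add: powr_diff)
    also have "\<dots> \<le> 1 * (\<Sum>i\<in>B. w i * b i powr q)"
      using nn' s0 s1 assms(2) by (intro mult_right_mono powr_le1) auto
    finally show ?thesis by (simp add: eq1 eq2)
  qed
qed

text \<open>Equivalent to superadditivity of the power with exponent
  \<open>s = 1 / r \<ge> 1\<close> on the values \<open>x powr r\<close> and
  \<open>y powr r\<close>. Superadditivity follows from
  \<open>c powr s \<le> c * (a + b) powr (s - 1)\<close> for \<open>c = a\<close> and
  \<open>c = b\<close>. With \<open>r = 1 / q\<close> the lemma later splits a \<open>q\<close>-th
  root of a sum.\<close>

lemma powr_add_le:
  fixes x y r :: real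
  assumes "0 \<le> x" "0 \<le> y" "0 < r" "r \<le> 1"
  shows "(x + y) powr r \<le> x powr r + y powr r"
proof -
  have "(x powr r + y powr r) powr (1 / r) \<ge> x + y"
  proof -
    have *: "a = (a powr r) powr (1 / r)" if "0 \<le> a" for a using that assms by (simp add: powr_powr)
    have sup: "a powr s + b powr s \<le> (a + b) powr s" if "0 \<le> a" "0 \<le> b" "1 \<le> s" for a b s :: real
    proof (cases "a + b = 0")
      case True
      then show ?thesis using that by (simp add: add_nonneg_eq_0_iff)
    next
      case False
      then have pos: "0 < a + b" using that by simp
      have le: "c powr s \<le> c * (a + b) powr (s - 1)" if "0 \<le> c" "c \<le> a + b" for c
      proof (cases "c = 0")
        case False
        then have "c powr s = c * c powr (s - 1)" using that by (simp add: powr_mult_base)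
        also have "\<dots> \<le> c * (a + b) powr (s - 1)"
          using that \<open>1 \<le> s\<close> by (intro mult_left_mono powr_mono2) auto
        finally show ?thesis .
      qed simp
      have "a powr s + b powr s \<le> (a + b) * (a + b) powr (s - 1)"
        using le[of a] le[of b] that by (simp add: distrib_right)
      also have "\<dots> = (a + b) powr s" using pos by (simp add: powr_mult_base)
      finally show ?thesis .
    qed
    have "x + y = (x powr r) powr (1 / r) + (y powr r) powr (1 / r)"
      using * assms by simp
    also have "\<dots> \<le> (x powr r + y powr r) powr (1 / r)"
      using assms by (intro sup) auto
    finally show ?thesis .
  qed
  then have "(x + y) powr r \<le> ((x powr r + y powr r) powr (1 / r)) powr r"
    using assms by (intro powr_mono2) auto
  also have "\<dots> = x powr r + y powr r"
    using assms by (simp add: powr_powr)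
  finally show ?thesis .
qed

section \<open>Weighted composition with a measure-preserving map\<close>

lemma Lq_funs_bounded_mult:
  assumes "f \<in> Lq_funs M q" "a \<in> borel_measurable M" "AE x in M. \<bar>a x\<bar> \<le> c" "1 \<le> q"
  shows "(\<lambda>x. a x * f x) \<in> Lq_funs M q"
proof -
  have [measurable]: "f \<in> borel_measurable M" "a \<in> borel_measurable M"
    and int: "integrable M (\<lambda>x. \<bar>f x\<bar> powr q)"
    using assms by (auto simp: Lq_funs_def)
  have "integrable M (\<lambda>x. \<bar>a x * f x\<bar> powr q)"
  proof (rule Bochner_Integration.integrable_bound)
    show "integrable M (\<lambda>x. \<bar>c\<bar> powr q * \<bar>f x\<bar> powr q)" using int by simp
    show "AE x in M. norm (\<bar>a x * f x\<bar> powr q) \<le> norm (\<bar>c\<bar> powr q * \<bar>f x\<bar> powr q)"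
      using assms(3)
    proof eventually_elim
      case (elim x)
      have "\<bar>a x\<bar> powr q \<le> \<bar>c\<bar> powr q" using elim assms(4) by (intro powr_mono2) auto
      then show ?case by (simp add: abs_mult powr_mult mult_right_mono)
    qed
  qed auto
  then show ?thesis by (auto simp: Lq_funs_def)
qed

locale measure_preserving_map =
  fixes M :: "'a measure" and T :: "'a \<Rightarrow> 'a"
  assumes measurable_T [measurable]: "T \<in> measurable M M"
    and distr_T: "distr M M T = M"
begin

lemma AE_comp: "AE x in M. P x \<Longrightarrow> AE x in M. P (T x)"
  using AE_distrD[OF measurable_T, of P] unfolding distr_T .

lemma integrable_comp:
  fixes f :: "'a \<Rightarrow> real"
  shows "integrable M f \<Longrightarrow> integrable M (\<lambda>x. f (T x))"
  using integrable_distr[of T M M f] by (simp add: distr_T)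

lemma integral_comp:
  fixes f :: "'a \<Rightarrow> real"
  shows "f \<in> borel_measurable M \<Longrightarrow> (\<integral>x. f (T x) \<partial>M) = (\<integral>x. f x \<partial>M)"
  using integral_distr[of T M M f] by (simp add: distr_T)

lemma nn_integral_comp_funpow:
  "f \<in> borel_measurable M \<Longrightarrow> (\<integral>\<^sup>+x. f ((T ^^ n) x) \<partial>M) = (\<integral>\<^sup>+x. f x \<partial>M)"
proof (induction n)
  case (Suc n)
  note [measurable] = Suc.prems
  have "(\<integral>\<^sup>+x. f ((T ^^ n) x) \<partial>M) = (\<integral>\<^sup>+x. f ((T ^^ n) x) \<partial>distr M M T)"
    by (simp add: distr_T)
  also have "\<dots> = (\<integral>\<^sup>+x. f ((T ^^ n) (T x)) \<partial>M)"
    by (rule nn_integral_distr) measurable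
  finally show ?case using Suc by (simp add: funpow_swap1)
qed simp

lemma Lq_funs_comp:
  assumes "f \<in> Lq_funs M q"
  shows "(\<lambda>x. f (T x)) \<in> Lq_funs M q"
  using assms integrable_comp[of "\<lambda>x. \<bar>f x\<bar> powr q"] by (auto simp: Lq_funs_def)

section \<open>A priori estimate and solvability of the fixed-point equation\<close>

lemma fixed_point_estimate:
  assumes "d \<in> Lq_funs M q" "u \<in> Lq_funs M q" "l \<in> Lq_funs M q" and q: "1 \<le> q"
    and a: "AE x in M. \<bar>a x\<bar> \<le> c" and c: "0 < c" "c < 1"
    and eq: "AE x in M. d x = u x + a x * (d (T x) - l (T x))"
  shows "(\<integral>x. \<bar>d x\<bar> powr q \<partial>M)
    \<le> (2 / (1 - c)) powr q * ((\<integral>x. \<bar>u x\<bar> powr q \<partial>M) + (\<integral>x. \<bar>l x\<bar> powr q \<partial>M))"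
proof -
  \<comment> \<open>Convexity of the power with weights $w, c, w$ makes the coefficient of the shifted
    $|d \circ T|^q$ exactly $c < 1$, so that it can be absorbed into the left-hand side.\<close>
  define K where "K = 2 / (1 - c)"
  define w where "w = (1 - c) / 2"
  have w: "0 < w" "w * K = 1" "2 * w + c = 1" "0 < K" using c by (auto simp: w_def K_def field_simps)
  have [measurable]: "d \<in> borel_measurable M" "u \<in> borel_measurable M" "l \<in> borel_measurable M"
    and int: "integrable M (\<lambda>x. \<bar>d x\<bar> powr q)" "integrable M (\<lambda>x. \<bar>u x\<bar> powr q)"
      "integrable M (\<lambda>x. \<bar>l x\<bar> powr q)"
    using assms by (auto simp: Lq_funs_def)
  note int' = int(1)[THEN integrable_comp] int(3)[THEN integrable_comp]
  let ?R = "\<lambda>x. w * K powr q * (\<bar>u x\<bar> powr q + \<bar>l (T x)\<bar> powr q) + c * \<bar>d (T x)\<bar> powr q"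
  have "AE x in M. \<bar>d x\<bar> powr q \<le> ?R x"
    using a eq
  proof eventually_elim
    case (elim x)
    define W where "W = (\<lambda>i::nat. if i = 0 then c else w)"
    \<comment> \<open>The values belonging to the weight \<open>w\<close> are scaled by
      \<open>K\<close> because \<open>w * K = 1\<close>: the weighted sum then returns
      \<open>\<bar>u x\<bar>\<close> and \<open>\<bar>l (T x)\<bar>\<close> with coefficient
      1.\<close>
    define b where "b = (\<lambda>i::nat. if i = 0 then \<bar>d (T x)\<bar> else if i = 1 then K * \<bar>u x\<bar> else K * \<bar>l (T x)\<bar>)"
    have expand: "(\<Sum>i<3. W i * F (b i))
        = c * F \<bar>d (T x)\<bar> + w * F (K * \<bar>u x\<bar>) + w * F (K * \<bar>l (T x)\<bar>)" for F :: "real \<Rightarrow> real"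
      by (simp add: W_def b_def eval_nat_numeral)
    have "\<bar>a x * (d (T x) - l (T x))\<bar> \<le> c * (\<bar>d (T x)\<bar> + \<bar>l (T x)\<bar>)"
      unfolding abs_mult using elim(1) c by (intro mult_mono) auto
    moreover have "c * \<bar>l (T x)\<bar> \<le> \<bar>l (T x)\<bar>" using c by (intro mult_left_le_one_le) auto
    ultimately have "\<bar>d x\<bar> \<le> \<bar>u x\<bar> + c * \<bar>d (T x)\<bar> + \<bar>l (T x)\<bar>"
      using elim(2) by (simp add: distrib_left)
    also have "\<dots> = (\<Sum>i<3. W i * b i)"
      using expand[of "\<lambda>x. x"] w by (simp flip: mult.assoc)
    finally have "\<bar>d x\<bar> powr q \<le> (\<Sum>i<3. W i * b i) powr q"
      using q by (intro powr_mono2) auto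
    also have "\<dots> \<le> (\<Sum>i<3. W i * b i powr q)"
      using w c by (intro powr_sum_le q) (auto simp: W_def b_def eval_nat_numeral)
    also have "\<dots> = ?R x"
      using expand[of "\<lambda>x. x powr q"] w by (simp add: powr_mult algebra_simps)
    finally show ?case .
  qed
  then have "(\<integral>x. \<bar>d x\<bar> powr q \<partial>M) \<le> (\<integral>x. ?R x \<partial>M)"
    using int int' by (intro integral_mono_AE) auto
  also have "\<dots> = w * K powr q * ((\<integral>x. \<bar>u x\<bar> powr q \<partial>M) + (\<integral>x. \<bar>l (T x)\<bar> powr q \<partial>M))
      + c * (\<integral>x. \<bar>d (T x)\<bar> powr q \<partial>M)"
    using int int' by simp
  also have "(\<integral>x. \<bar>l (T x)\<bar> powr q \<partial>M) = (\<integral>x. \<bar>l x\<bar> powr q \<partial>M)"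
    by (rule integral_comp) simp
  also have "(\<integral>x. \<bar>d (T x)\<bar> powr q \<partial>M) = (\<integral>x. \<bar>d x\<bar> powr q \<partial>M)"
    by (rule integral_comp) simp
  finally have "(1 - c) * (\<integral>x. \<bar>d x\<bar> powr q \<partial>M)
      \<le> w * (K powr q * ((\<integral>x. \<bar>u x\<bar> powr q \<partial>M) + (\<integral>x. \<bar>l x\<bar> powr q \<partial>M)))"
    by (simp add: algebra_simps)
  \<comment> \<open>Replacing \<open>w = (1 - c) / 2\<close> by the larger \<open>1 - c\<close> lets
    this factor cancel against the one on the left, which leaves the constant
    \<open>K powr q\<close>.\<close>
  also have "\<dots> \<le> (1 - c) * (K powr q * ((\<integral>x. \<bar>u x\<bar> powr q \<partial>M) + (\<integral>x. \<bar>l x\<bar> powr q \<partial>M)))"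
    using w by (intro mult_right_mono mult_nonneg_nonneg add_nonneg_nonneg integral_nonneg) auto
  finally show ?thesis using c by (simp add: K_def)
qed

text \<open>The Neumann series is summed pointwise almost everywhere and then shown to have a
  \<open>q\<close>-integrable sum. The bound on \<open>a\<close> holds at every point, so that the
  products \<open>P n x\<close> along an orbit are bounded by \<open>c ^ n\<close> without
  exceptional sets.\<close>

lemma fixed_point_exists:
  assumes u: "u \<in> Lq_funs M q" and q: "1 \<le> q" and [measurable]: "a \<in> borel_measurable M"
    and a: "\<And>x. \<bar>a x\<bar> \<le> c" and c: "0 < c" "c < 1"
  shows "\<exists>g\<in>Lq_funs M q. AE x in M. g x = u x + a x * g (T x)"
proof -
  have [measurable]: "u \<in> borel_measurable M" and int: "integrable M (\<lambda>x. \<bar>u x\<bar> powr q)"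
    using u by (auto simp: Lq_funs_def)
  define P where "P n x = (\<Prod>i<n. a ((T ^^ i) x))" for n x
  define g where "g x = (\<Sum>n. P n x * u ((T ^^ n) x))" for x
  \<comment> \<open>This one series controls everything. Since \<open>T\<close> preserves
    \<open>M\<close>, its integral is the geometric series in \<open>c\<close> times the integral of
    \<open>\<bar>u x\<bar> powr q\<close>, hence finite. So \<open>S\<close> is finite almost
    everywhere, which gives convergence of the series for \<open>g\<close>, and \<open>S\<close>
    dominates \<open>\<bar>g x\<bar> powr q\<close> up to a constant.\<close>
  define S where "S x = (\<Sum>n. ennreal (c ^ n * \<bar>u ((T ^^ n) x)\<bar> powr q))" for x
  have [measurable]: "P n \<in> borel_measurable M" for n unfolding P_def by measurable
  have g_meas [measurable]: "g \<in> borel_measurable M" unfolding g_def by measurable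
  have [measurable]: "S \<in> borel_measurable M" unfolding S_def by measurable
  have P: "\<bar>P n x\<bar> \<le> c ^ n" for n x
  proof -
    have "(\<Prod>i<n. \<bar>a ((T ^^ i) x)\<bar>) \<le> (\<Prod>i<n. c)" by (intro prod_mono) (use a in auto)
    then show ?thesis by (simp add: P_def abs_prod)
  qed
  let ?U = "\<integral>x. \<bar>u x\<bar> powr q \<partial>M"
  have U: "(\<integral>\<^sup>+x. ennreal (\<bar>u x\<bar> powr q) \<partial>M) = ennreal ?U"
    using int by (intro nn_integral_eq_integral) auto
  have summable_c: "summable (\<lambda>n. c ^ n)" using c by (intro summable_geometric) auto
  have "(\<integral>\<^sup>+x. S x \<partial>M) = (\<Sum>n. \<integral>\<^sup>+x. ennreal (c ^ n) * ennreal (\<bar>u ((T ^^ n) x)\<bar> powr q) \<partial>M)"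
    unfolding S_def using c by (subst nn_integral_suminf) (auto simp: ennreal_mult)
  also have "\<dots> = (\<Sum>n. ennreal (c ^ n) * ennreal ?U)"
  proof (rule suminf_cong)
    fix n
    have "(\<integral>\<^sup>+x. ennreal (c ^ n) * ennreal (\<bar>u ((T ^^ n) x)\<bar> powr q) \<partial>M)
        = ennreal (c ^ n) * (\<integral>\<^sup>+x. ennreal (\<bar>u ((T ^^ n) x)\<bar> powr q) \<partial>M)"
      by (rule nn_integral_cmult) measurable
    then show "(\<integral>\<^sup>+x. ennreal (c ^ n) * ennreal (\<bar>u ((T ^^ n) x)\<bar> powr q) \<partial>M) = ennreal (c ^ n) * ennreal ?U"
      using nn_integral_comp_funpow[of "\<lambda>x. ennreal (\<bar>u x\<bar> powr q)" n] U by simp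
  qed
  also have "\<dots> = (\<Sum>n. ennreal (c ^ n * ?U))"
    using c by (intro suminf_cong) (simp add: ennreal_mult)
  also have "\<dots> < \<infinity>"
    unfolding infinity_ennreal_def less_top[symmetric]
    by (rule ennreal_suminf_neq_top[OF summable_mult2[OF summable_c]]) (use c in auto)
  finally have S_int: "(\<integral>\<^sup>+x. S x \<partial>M) < \<infinity>" .
  then have S_fin: "AE x in M. S x \<noteq> \<infinity>"
    by (intro nn_integral_noteq_infinite) auto
  have sum_q: "summable (\<lambda>n. c ^ n * \<bar>u ((T ^^ n) x)\<bar> powr q)" if "S x \<noteq> \<infinity>" for x
    using that c unfolding S_def by (intro summable_suminf_not_top) auto
  have sum_1: "summable (\<lambda>n. c ^ n * \<bar>u ((T ^^ n) x)\<bar>)" if "S x \<noteq> \<infinity>" for x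
  proof (rule summable_comparison_test'[OF summable_add[OF summable_c sum_q[OF that]]])
    fix n
    \<comment> \<open>Since \<open>q \<ge> 1\<close>, the first power is dominated by
      \<open>1 + t powr q\<close>, and both resulting series converge: the geometric one and the one
      behind \<open>S x\<close>.\<close>
    have "t \<le> 1 + t powr q" if "0 \<le> t" for t :: real
    proof (cases "t \<le> 1")
      case False
      then have "t powr 1 \<le> t powr q" using q by (intro powr_mono) auto
      then show ?thesis using False by simp
    qed (simp add: add_increasing2)
    then have "c ^ n * \<bar>u ((T ^^ n) x)\<bar> \<le> c ^ n * (1 + \<bar>u ((T ^^ n) x)\<bar> powr q)"
      using c by (intro mult_left_mono) auto
    then show "norm (c ^ n * \<bar>u ((T ^^ n) x)\<bar>) \<le> c ^ n + c ^ n * \<bar>u ((T ^^ n) x)\<bar> powr q"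
      using c by (simp add: distrib_left)
  qed
  have bnd: "\<bar>P n x * u z\<bar> \<le> c ^ n * \<bar>u z\<bar>" for n x z
    unfolding abs_mult by (intro mult_right_mono P) auto
  have sum_g: "summable (\<lambda>n. P n x * u ((T ^^ n) x))" if "S x \<noteq> \<infinity>" for x
    by (rule summable_comparison_test'[OF sum_1[OF that]]) (use bnd in simp)
  have "AE x in M. g x = u x + a x * g (T x)"
    using S_fin
  proof eventually_elim
    case (elim x)
    \<comment> \<open>The terms at \<open>T x\<close>, multiplied by \<open>c\<close>, are the terms
      at \<open>x\<close> with the index shifted by one. Dividing by \<open>c > 0\<close>,
      finiteness of \<open>S x\<close> gives convergence at \<open>T x\<close> as well as at
      \<open>x\<close>.\<close>
    have "summable (\<lambda>n. c * (c ^ n * \<bar>u ((T ^^ n) (T x))\<bar>))"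
      using sum_1[OF elim] by (subst (asm) summable_Suc_iff[symmetric]) (simp add: funpow_swap1 mult.assoc)
    then have "summable (\<lambda>n. c ^ n * \<bar>u ((T ^^ n) (T x))\<bar>)"
      using c by (subst (asm) summable_cmult_iff) auto
    then have sum_T: "summable (\<lambda>n. P n (T x) * u ((T ^^ n) (T x)))"
      by (rule summable_comparison_test') (use bnd in simp)
    have P_Suc: "P (Suc n) x = a x * P n (T x)" for n
      unfolding P_def by (subst prod.lessThan_Suc_shift) (simp add: funpow_swap1)
    have "g x = P 0 x * u ((T ^^ 0) x) + (\<Sum>n. P (Suc n) x * u ((T ^^ Suc n) x))"
      unfolding g_def using suminf_split_head[OF sum_g[OF elim]] by simp
    also have "(\<Sum>n. P (Suc n) x * u ((T ^^ Suc n) x)) = (\<Sum>n. a x * (P n (T x) * u ((T ^^ n) (T x))))"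
      by (simp add: P_Suc funpow_swap1 mult.assoc)
    also have "\<dots> = a x * g (T x)"
      unfolding g_def by (rule suminf_mult[OF sum_T])
    finally show ?case by (simp add: P_def)
  qed
  moreover have "g \<in> Lq_funs M q"
  proof -
    \<comment> \<open>The weights \<open>(1 - c) * c ^ n\<close> have partial sums at most 1, as
      \<open>powr_sum_le\<close> demands. The compensating factor \<open>1 / (1 - c)\<close> on the
      values comes out as its \<open>q\<close>-th power, and one \<open>1 - c\<close> remains from
      the weights. The bound is proved for partial sums and passes to the limit.\<close>
    let ?K = "(1 / (1 - c)) powr q * (1 - c)"
    have bound: "\<bar>g x\<bar> powr q \<le> ?K * (\<Sum>n. c ^ n * \<bar>u ((T ^^ n) x)\<bar> powr q)" if x: "S x \<noteq> \<infinity>" for x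
    proof (rule LIMSEQ_le_const2)
      show "(\<lambda>m. \<bar>\<Sum>n<m. P n x * u ((T ^^ n) x)\<bar> powr q) \<longlonglongrightarrow> \<bar>g x\<bar> powr q"
        unfolding g_def using summable_LIMSEQ[OF sum_g[OF x]] q
        by (intro tendsto_powr2 tendsto_rabs tendsto_const) auto
      have "\<bar>\<Sum>n<m. P n x * u ((T ^^ n) x)\<bar> powr q
          \<le> ?K * (\<Sum>n. c ^ n * \<bar>u ((T ^^ n) x)\<bar> powr q)" for m
      proof -
        have "\<bar>\<Sum>n<m. P n x * u ((T ^^ n) x)\<bar> \<le> (\<Sum>n<m. c ^ n * \<bar>u ((T ^^ n) x)\<bar>)"
          using bnd by (intro order_trans[OF sum_abs] sum_mono) auto
        also have "\<dots> = (\<Sum>n<m. ((1 - c) * c ^ n) * (1 / (1 - c) * \<bar>u ((T ^^ n) x)\<bar>))"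
          using c by (intro sum.cong) auto
        finally have "\<bar>\<Sum>n<m. P n x * u ((T ^^ n) x)\<bar> powr q
            \<le> (\<Sum>n<m. ((1 - c) * c ^ n) * (1 / (1 - c) * \<bar>u ((T ^^ n) x)\<bar>)) powr q"
          using q by (intro powr_mono2) auto
        also have "\<dots> \<le> (\<Sum>n<m. ((1 - c) * c ^ n) * (1 / (1 - c) * \<bar>u ((T ^^ n) x)\<bar>) powr q)"
        proof (intro powr_sum_le q)
          have "(\<Sum>n<m. (1 - c) * c ^ n) = 1 - c ^ m"
            using c by (simp add: sum_gp_strict flip: sum_distrib_left)
          then show "(\<Sum>n<m. (1 - c) * c ^ n) \<le> 1" using c by simp
        qed (use c in auto)
        also have "\<dots> = ?K * (\<Sum>n<m. c ^ n * \<bar>u ((T ^^ n) x)\<bar> powr q)"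
          unfolding sum_distrib_left
          using c by (intro sum.cong refl) (subst powr_mult, auto)
        also have "\<dots> \<le> ?K * (\<Sum>n. c ^ n * \<bar>u ((T ^^ n) x)\<bar> powr q)"
          using c sum_q[OF x] by (intro mult_left_mono sum_le_suminf) auto
        finally show ?thesis .
      qed
      then show "\<exists>m0. \<forall>m\<ge>m0. \<bar>\<Sum>n<m. P n x * u ((T ^^ n) x)\<bar> powr q
          \<le> ?K * (\<Sum>n. c ^ n * \<bar>u ((T ^^ n) x)\<bar> powr q)" by blast
    qed
    have S_eq: "S x = ennreal (\<Sum>n. c ^ n * \<bar>u ((T ^^ n) x)\<bar> powr q)" if "S x \<noteq> \<infinity>" for x
      using that c unfolding S_def by (intro suminf_ennreal) auto
    have "(\<integral>\<^sup>+x. ennreal (norm (\<bar>g x\<bar> powr q)) \<partial>M) \<le> (\<integral>\<^sup>+x. ennreal ?K * S x \<partial>M)"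
    proof (rule nn_integral_mono_AE)
      show "AE x in M. ennreal (norm (\<bar>g x\<bar> powr q)) \<le> ennreal ?K * S x"
        using S_fin
      proof eventually_elim
        case (elim x)
        have "ennreal (\<bar>g x\<bar> powr q) \<le> ennreal (?K * (\<Sum>n. c ^ n * \<bar>u ((T ^^ n) x)\<bar> powr q))"
          using bound[OF elim] by (rule ennreal_leI)
        also have "\<dots> = ennreal ?K * S x"
          using c sum_q[OF elim] by (subst S_eq[OF elim], subst ennreal_mult) (auto intro!: suminf_nonneg)
        finally show ?case by simp
      qed
    qed
    also have "\<dots> = ennreal ?K * (\<integral>\<^sup>+x. S x \<partial>M)" by (rule nn_integral_cmult) measurable
    also have "\<dots> < \<infinity>" using S_int by (simp add: ennreal_mult_less_top)
    finally have "integrable M (\<lambda>x. \<bar>g x\<bar> powr q)"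
      by (intro integrableI_bounded) measurable
    then show ?thesis using g_meas by (simp add: Lq_funs_def)
  qed
  ultimately show ?thesis by blast
qed

end

section \<open>The piecewise inverse of the cell maps\<close>

lemma interval_subdivision:
  fixes y :: "nat \<Rightarrow> real"
  assumes "1 \<le> N" "y 0 \<le> z" "z \<le> y N"
  shows "\<exists>i\<in>{1..N}. y (i - 1) \<le> z \<and> z \<le> y i"
  using assms
proof (induction N rule: dec_induct)
  case base
  then show ?case by auto
next
  case (step n)
  show ?case
  proof (cases "z \<le> y n")
    case True
    then show ?thesis using step by fastforce
  next
    case False
    then show ?thesis using step.prems by (intro bexI[of _ "Suc n"]) auto
  qed
qed

locale alternating_net =
  fixes N :: "'n::finite \<Rightarrow> nat"
    and y :: "'n \<Rightarrow> nat \<Rightarrow> real"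
    and v :: "'n \<Rightarrow> nat \<Rightarrow> real \<Rightarrow> real"
  assumes N_pos: "\<And>k. 1 \<le> N k"
    and y_mono: "\<And>k. strict_mono_on {0..N k} (y k)"
    and v_homeomorphism: "\<And>k i. i \<in> {1..N k} \<Longrightarrow>
      \<exists>w. homeomorphism (axis_interval N y k) (axis_subinterval y k i) (v k i) w"
    and v_odd: "\<And>k i. i \<in> {1..N k} \<Longrightarrow> odd i \<Longrightarrow>
      v k i (y k 0) = y k (i - 1) \<and> v k i (y k (N k)) = y k i"
    and v_even: "\<And>k i. i \<in> {1..N k} \<Longrightarrow> even i \<Longrightarrow>
      v k i (y k 0) = y k i \<and> v k i (y k (N k)) = y k (i - 1)"
begin

section \<open>The one-dimensional maps and their agreement at the knots\<close>

lemma y_le: "a \<le> b \<Longrightarrow> b \<le> N k \<Longrightarrow> y k a \<le> y k b"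
  using strict_mono_on_leD[OF y_mono[of k], of a b] by auto

lemma v_image: "i \<in> {1..N k} \<Longrightarrow> v k i ` axis_interval N y k = axis_subinterval y k i"
  using v_homeomorphism[of i k] by (auto simp: homeomorphism_def)

lemma v_inj: "i \<in> {1..N k} \<Longrightarrow> inj_on (v k i) (axis_interval N y k)"
  using v_homeomorphism[of i k] by (auto simp: homeomorphism_def intro: inj_on_inverseI)

lemma v_continuous: "i \<in> {1..N k} \<Longrightarrow> continuous_on (axis_interval N y k) (v k i)"
  using v_homeomorphism[of i k] by (auto simp: homeomorphism_def)

text \<open>Two adjacent subintervals share a knot, and the alternating orientation makes both maps send
  the same endpoint there. This is what makes \<open>piecewise_inv\<close> below well defined on all
  of \<open>net_box N y\<close>, so that null sets of cell boundaries never enter.\<close>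

lemma v_consistent:
  assumes "i \<in> {1..N k}" "j \<in> {1..N k}" "s \<in> axis_interval N y k" "t \<in> axis_interval N y k"
    and "v k i s = v k j t"
  shows "s = t"
proof -
  have wlog: "s = t"
    if ij: "i \<le> j" "i \<in> {1..N k}" "j \<in> {1..N k}"
      and st: "s \<in> axis_interval N y k" "t \<in> axis_interval N y k"
      and eq: "v k i s = v k j t" for i j s t
  proof (cases "i = j")
    case True
    then show ?thesis using v_inj[OF ij(2)] st eq by (auto dest: inj_onD)
  next
    case False
    have ends: "y k 0 \<in> axis_interval N y k" "y k (N k) \<in> axis_interval N y k"
      using y_le[of 0 "N k" k] by (auto simp: axis_interval_def)
    have "v k i s \<in> axis_subinterval y k i" "v k j t \<in> axis_subinterval y k j"
      using v_image ij st by blast+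
    then have bounds: "v k i s \<le> y k i" "y k (j - 1) \<le> v k i s"
      using eq by (auto simp: axis_subinterval_def)
    \<comment> \<open>A value common to two different subintervals lies between
      \<open>y k (j - 1)\<close> and \<open>y k i\<close>. As the knots increase strictly, the
      subintervals are neighbours and the value is their shared knot.\<close>
    have "j - 1 = i"
    proof (rule ccontr)
      assume "j - 1 \<noteq> i"
      then have "i < j - 1" using False ij(1) by simp
      then have "y k i < y k (j - 1)"
        using ij by (intro strict_mono_onD[OF y_mono[of k]]) auto
      then show False using bounds by simp
    qed
    then have j: "j = Suc i" using ij by auto
    have val: "v k i s = y k i" "v k j t = y k i" using bounds eq j by auto
    show ?thesis
    proof (cases "odd i")
      case True
      then have "v k i s = v k i (y k (N k))" "v k j t = v k j (y k (N k))"
        using v_odd[OF ij(2)] v_even[OF ij(3)] val j by auto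
      then show ?thesis using v_inj ij st ends by (metis inj_onD)
    next
      case False
      then have "v k i s = v k i (y k 0)" "v k j t = v k j (y k 0)"
        using v_even[OF ij(2)] v_odd[OF ij(3)] val j by auto
      then show ?thesis using v_inj ij st ends by (metis inj_onD)
    qed
  qed
  show ?thesis
    using wlog[of i j s t] wlog[of j i t s] assms by (metis linear)
qed

section \<open>Cells of the net and the maps \<open>Theta v j\<close>\<close>

lemma finite_multi_indices: "finite (multi_indices N)"
proof -
  have "multi_indices N = PiE UNIV (\<lambda>k. {1..N k})" by (auto simp: multi_indices_def)
  then show ?thesis by (simp add: finite_PiE)
qed

lemma compact_net_box: "compact (net_box N y)"
proof -
  have "net_box N y = cbox (\<chi> k. y k 0) (\<chi> k. y k (N k))"
    by (auto simp: net_box_def axis_interval_def mem_box_cart)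
  then show ?thesis by simp
qed

lemma Theta_image:
  assumes "j \<in> multi_indices N"
  shows "Theta v j ` net_box N y = cell y j"
proof -
  have j: "j k \<in> {1..N k}" for k using assms by (simp add: multi_indices_def)
  show ?thesis
  proof (intro equalityI subsetI)
    fix x assume "x \<in> Theta v j ` net_box N y"
    then show "x \<in> cell y j"
      by (auto simp: Theta_def net_box_def cell_def simp flip: v_image[OF j])
  next
    fix x assume "x \<in> cell y j"
    then have "\<forall>k. \<exists>s\<in>axis_interval N y k. v k (j k) s = x $ k"
      unfolding cell_def v_image[OF j, symmetric] by (metis (mono_tags, lifting) imageE mem_Collect_eq)
    then obtain s where s: "\<And>k. s k \<in> axis_interval N y k" "\<And>k. v k (j k) (s k) = x $ k"
      by metis
    then show "x \<in> Theta v j ` net_box N y"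
      by (intro image_eqI[of _ _ "\<chi> k. s k"]) (auto simp: Theta_def net_box_def vec_eq_iff)
  qed
qed

text \<open>This is \<open>v_consistent\<close> in every coordinate. For \<open>i = j\<close> it
  gives injectivity of a single map on the box; for \<open>i \<noteq> j\<close> it says that the
  inverses agree where two cells overlap.\<close>

lemma Theta_consistent:
  assumes "i \<in> multi_indices N" "j \<in> multi_indices N" "a \<in> net_box N y" "b \<in> net_box N y"
    and "Theta v i a = Theta v j b"
  shows "a = b"
proof -
  have "a $ k = b $ k" for k
  proof (rule v_consistent)
    show "i k \<in> {1..N k}" "j k \<in> {1..N k}" using assms(1,2) by (simp_all add: multi_indices_def)
    show "a $ k \<in> axis_interval N y k" "b $ k \<in> axis_interval N y k"
      using assms(3,4) by (simp_all add: net_box_def)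
    have "Theta v i a $ k = Theta v j b $ k" using assms(5) by (rule arg_cong)
    then show "v k (i k) (a $ k) = v k (j k) (b $ k)" by (simp add: Theta_def)
  qed
  then show ?thesis by (simp add: vec_eq_iff)
qed

lemma cell_subset_net_box:
  assumes "j \<in> multi_indices N"
  shows "cell y j \<subseteq> net_box N y"
proof
  fix x assume x: "x \<in> cell y j"
  show "x \<in> net_box N y"
    unfolding net_box_def
  proof safe
    fix k
    have "j k \<in> {1..N k}" using assms by (simp add: multi_indices_def)
    then have "y k 0 \<le> y k (j k - 1)" "y k (j k) \<le> y k (N k)" by (auto intro!: y_le)
    moreover have "x $ k \<in> axis_subinterval y k (j k)" using x by (simp add: cell_def)
    ultimately show "x $ k \<in> axis_interval N y k"
      by (auto simp: axis_subinterval_def axis_interval_def)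
  qed
qed

lemma net_box_covered:
  assumes "x \<in> net_box N y"
  shows "\<exists>j\<in>multi_indices N. x \<in> cell y j"
proof -
  have "\<forall>k. \<exists>i\<in>{1..N k}. y k (i - 1) \<le> x $ k \<and> x $ k \<le> y k i"
    using assms by (intro allI interval_subdivision N_pos) (simp_all add: net_box_def axis_interval_def)
  then obtain j where "\<And>k. j k \<in> {1..N k} \<and> y k (j k - 1) \<le> x $ k \<and> x $ k \<le> y k (j k)"
    by metis
  then show ?thesis
    by (intro bexI[of _ j]) (auto simp: multi_indices_def cell_def axis_subinterval_def)
qed

section \<open>The glued inverse and its invariance properties\<close>

definition piecewise_inv :: "real ^ 'n \<Rightarrow> real ^ 'n" where
  "piecewise_inv x = Theta_inv N y v (SOME j. j \<in> multi_indices N \<and> x \<in> cell y j) x"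

text \<open>Makes the choice by \<open>SOME\<close> immaterial: at a point of several cells, the
  corresponding preimages in the box coincide by \<open>Theta_consistent\<close>.\<close>

lemma piecewise_inv_cell:
  assumes "j \<in> multi_indices N" "x \<in> cell y j"
  shows "piecewise_inv x = Theta_inv N y v j x"
proof -
  define i where "i = (SOME j. j \<in> multi_indices N \<and> x \<in> cell y j)"
  have i: "i \<in> multi_indices N \<and> x \<in> cell y i"
    unfolding i_def by (rule someI[of _ j]) (intro conjI assms)
  have inv: "Theta_inv N y v l x \<in> net_box N y" "Theta v l (Theta_inv N y v l x) = x"
    if "l \<in> multi_indices N" "x \<in> cell y l" for l
    using that(2) unfolding Theta_image[OF that(1), symmetric]
    by (rule inv_into_into, rule f_inv_into_f)
  have "Theta_inv N y v i x = Theta_inv N y v j x"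
  proof (rule Theta_consistent)
    show "Theta v i (Theta_inv N y v i x) = Theta v j (Theta_inv N y v j x)"
      using i assms inv(2) by simp
  qed (use i assms inv(1) in blast)+
  then show ?thesis by (simp add: piecewise_inv_def i_def)
qed

lemma piecewise_inv_Theta:
  assumes "j \<in> multi_indices N" "a \<in> net_box N y"
  shows "piecewise_inv (Theta v j a) = a"
proof -
  have inj: "inj_on (Theta v j) (net_box N y)"
    by (intro inj_onI) (rule Theta_consistent[OF assms(1) assms(1)])
  have "Theta v j a \<in> cell y j"
    unfolding Theta_image[OF assms(1), symmetric] using assms(2) by (rule imageI)
  from piecewise_inv_cell[OF assms(1) this] show ?thesis
    using inv_into_f_f[OF inj assms(2)] by (rule trans)
qed

lemma net_box_cases:
  assumes "x \<in> net_box N y"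
  obtains j a where "j \<in> multi_indices N" "a \<in> net_box N y" "x = Theta v j a"
proof -
  from net_box_covered[OF assms] obtain j where j: "j \<in> multi_indices N" "x \<in> cell y j"
    by (rule bexE)
  from j(2) obtain a where "x = Theta v j a" "a \<in> net_box N y"
    unfolding Theta_image[OF j(1), symmetric] by (rule imageE)
  then show thesis using that[OF j(1)] by simp
qed

lemma Theta_net_box:
  assumes "j \<in> multi_indices N" "a \<in> net_box N y"
  shows "Theta v j a \<in> net_box N y"
  using cell_subset_net_box[OF assms(1)] imageI[OF assms(2), of "Theta v j"]
  unfolding Theta_image[OF assms(1)] by (rule subsetD)

lemma piecewise_inv_net_box:
  assumes "x \<in> net_box N y"
  shows "piecewise_inv x \<in> net_box N y"
  using assms by (rule net_box_cases) (simp add: piecewise_inv_Theta)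

text \<open>Turns preimages under the glued inverse into finite unions of forward images under the
  continuous maps \<open>Theta v j\<close>, the form used for measurability.\<close>

lemma piecewise_inv_vimage:
  "piecewise_inv -` B \<inter> net_box N y = (\<Union>j\<in>multi_indices N. Theta v j ` (B \<inter> net_box N y))"
proof (intro equalityI subsetI)
  fix x assume x: "x \<in> piecewise_inv -` B \<inter> net_box N y"
  then have "x \<in> net_box N y" by (rule IntD2)
  then obtain j a where j: "j \<in> multi_indices N" "a \<in> net_box N y" "x = Theta v j a"
    by (rule net_box_cases)
  then have "a \<in> B" using x by (simp add: piecewise_inv_Theta)
  then show "x \<in> (\<Union>j\<in>multi_indices N. Theta v j ` (B \<inter> net_box N y))"
    unfolding j(3) by (intro UN_I[OF j(1)] imageI IntI j(2))
next
  fix x assume "x \<in> (\<Union>j\<in>multi_indices N. Theta v j ` (B \<inter> net_box N y))"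
  then obtain j a where "j \<in> multi_indices N" "a \<in> B" "a \<in> net_box N y" "x = Theta v j a"
    by (elim UN_E imageE IntE)
  then show "x \<in> piecewise_inv -` B \<inter> net_box N y"
    by (simp add: Theta_net_box piecewise_inv_Theta)
qed

text \<open>For closed \<open>C\<close>, the set \<open>C \<inter> net_box N y\<close> is compact,
  so its images under the continuous maps \<open>Theta v j\<close> are compact and their finite
  union is closed. Preimages of open sets follow by complements within the box.\<close>

lemma piecewise_inv_measurable:
  "piecewise_inv \<in> measurable (restrict_space borel (net_box N y)) (restrict_space borel (net_box N y))"
proof (rule measurable_restrict_space2)
  let ?R = "restrict_space borel (net_box N y)"
  show "piecewise_inv \<in> space ?R \<rightarrow> net_box N y"
    by (simp add: space_restrict_space piecewise_inv_net_box)
  have closed: "piecewise_inv -` C \<inter> net_box N y \<in> sets ?R" if "closed C" for C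
  proof -
    have "compact (Theta v j ` (C \<inter> net_box N y))" if j: "j \<in> multi_indices N" for j
    proof (rule compact_continuous_image)
      show "compact (C \<inter> net_box N y)"
        using \<open>closed C\<close> compact_net_box by (rule closed_Int_compact)
      have "continuous_on (net_box N y) (\<lambda>x. v k (j k) (x $ k))" for k
        using j by (intro continuous_on_compose2[OF v_continuous[of "j k" k]] continuous_intros)
          (auto simp: multi_indices_def net_box_def)
      then show "continuous_on (C \<inter> net_box N y) (Theta v j)"
        unfolding Theta_def
        by (intro continuous_on_vec_lambda) (auto intro: continuous_on_subset)
    qed
    then have "closed (piecewise_inv -` C \<inter> net_box N y)"
      unfolding piecewise_inv_vimage
      by (intro closed_UN finite_multi_indices) (auto intro: compact_imp_closed)
    then have "piecewise_inv -` C \<inter> net_box N y \<in> sets borel" by (rule borel_closed)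
    then show ?thesis
      unfolding sets_restrict_space
      by (intro image_eqI[where x = "piecewise_inv -` C \<inter> net_box N y"])
        (simp_all add: Int_ac)
  qed
  show "piecewise_inv \<in> borel_measurable ?R"
  proof (rule borel_measurableI)
    fix S :: "(real ^ 'n) set" assume "open S"
    then have "space ?R - (piecewise_inv -` (- S) \<inter> net_box N y) \<in> sets ?R"
      by (intro sets.Diff sets.top closed) auto
    also have "space ?R - (piecewise_inv -` (- S) \<inter> net_box N y) = piecewise_inv -` S \<inter> space ?R"
      by (simp add: space_restrict_space) blast
    finally show "piecewise_inv -` S \<inter> space ?R \<in> sets ?R" .
  qed
qed

text \<open>Self-similarity is applied to the preimage of \<open>B\<close> under
  \<open>piecewise_inv\<close>. Since \<open>piecewise_inv\<close> undoes every
  \<open>Theta v j\<close>, each summand becomes \<open>p j * measure \<mu> B\<close>, and the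
  weights sum to 1.\<close>

lemma piecewise_inv_measure_preserving:
  assumes inv: "invariant_prob N y v p \<mu>" and p: "(\<Sum>j\<in>multi_indices N. p j) = 1"
  shows "measure_preserving_map \<mu> piecewise_inv"
proof -
  interpret prob_space \<mu> using inv by (simp add: invariant_prob_def)
  have space: "space \<mu> = net_box N y" and sets: "sets \<mu> = sets (restrict_space borel (net_box N y))"
    and meas: "\<And>B. B \<in> sets \<mu> \<Longrightarrow>
      measure \<mu> B = (\<Sum>j\<in>multi_indices N. p j * measure \<mu> (Theta v j -` B \<inter> net_box N y))"
    using inv by (auto simp: invariant_prob_def)
  have T: "piecewise_inv \<in> measurable \<mu> \<mu>"
    using piecewise_inv_measurable by (simp add: measurable_cong_sets[OF sets sets])
  have "distr \<mu> \<mu> piecewise_inv = \<mu>"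
  proof (rule measure_eqI)
    fix B assume "B \<in> sets (distr \<mu> \<mu> piecewise_inv)"
    then have B: "B \<in> sets \<mu>" by simp
    then have B_sub: "B \<subseteq> net_box N y" using sets.sets_into_space space by blast
    have "measure \<mu> (piecewise_inv -` B \<inter> space \<mu>)
        = (\<Sum>j\<in>multi_indices N. p j * measure \<mu> (Theta v j -` (piecewise_inv -` B \<inter> space \<mu>) \<inter> net_box N y))"
      using T B by (intro meas measurable_sets)
    also have "\<dots> = (\<Sum>j\<in>multi_indices N. p j * measure \<mu> B)"
    proof (rule sum.cong[OF refl])
      fix j assume j: "j \<in> multi_indices N"
      have "Theta v j -` (piecewise_inv -` B \<inter> space \<mu>) \<inter> net_box N y = B"
        using B_sub by (auto simp: space piecewise_inv_Theta[OF j] Theta_net_box[OF j])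
      then show "p j * measure \<mu> (Theta v j -` (piecewise_inv -` B \<inter> space \<mu>) \<inter> net_box N y)
          = p j * measure \<mu> B" by simp
    qed
    also have "\<dots> = measure \<mu> B" using p by (simp flip: sum_distrib_right)
    finally show "emeasure (distr \<mu> \<mu> piecewise_inv) B = emeasure \<mu> B"
      using T B by (simp add: emeasure_distr emeasure_eq_measure)
  qed simp
  then show ?thesis using T by unfold_locales
qed

end

section \<open>The fractal operator\<close>

lemma Lq_cases:
  assumes "X \<in> Lq M q"
  obtains f where "f \<in> Lq_funs M q" "X = Lq_rel M q `` {f}"
  using assms unfolding Lq_def by (rule quotientE)

lemma Lq_classI: "f \<in> Lq_funs M q \<Longrightarrow> Lq_rel M q `` {f} \<in> Lq M q"
  unfolding Lq_def by (rule quotientI)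

lemma Lq_dist_class:
  assumes "1 \<le> q" "f \<in> Lq_funs M q" "g \<in> Lq_funs M q"
  shows "Lq_dist M q (Lq_rel M q `` {f}) (Lq_rel M q `` {g})
    = (\<integral>x. \<bar>f x - g x\<bar> powr q \<partial>M) powr (1 / q)"
  using Lq_funs_comb[OF assms, of 1 "-1"]
  by (simp add: Lq_comb_class[OF assms] Lq_norm_class)

section \<open>The defining equation on representatives and the Lipschitz estimate\<close>

context alternating_net
begin

text \<open>Finitely many cells cover the box, so the equations on the cells merge into a single one
  almost everywhere. Conversely, one choice of representatives suffices: composing with
  \<open>piecewise_inv\<close> respects equality almost everywhere because that map preserves
  \<open>\<mu>\<close>.\<close>

lemma self_referential_class_iff:
  assumes inv: "invariant_prob N y v p \<mu>" and p: "(\<Sum>j\<in>multi_indices N. p j) = 1"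
    and fs: "f \<in> Lq_funs \<mu> q" "l \<in> Lq_funs \<mu> q" "g \<in> Lq_funs \<mu> q"
  shows "self_referential N y v \<mu> \<alpha> (Lq_rel \<mu> q `` {f}) (Lq_rel \<mu> q `` {l}) (Lq_rel \<mu> q `` {g})
    \<longleftrightarrow> (AE x in \<mu>. g x = f x + \<alpha> x * (g (piecewise_inv x) - l (piecewise_inv x)))"
    (is "?S \<longleftrightarrow> ?E")
proof
  interpret measure_preserving_map \<mu> piecewise_inv
    using inv p by (rule piecewise_inv_measure_preserving)
  have space: "space \<mu> = net_box N y" using inv by (simp add: invariant_prob_def)
  show ?E if ?S
  proof -
    have "f \<in> Lq_rel \<mu> q `` {f}" "l \<in> Lq_rel \<mu> q `` {l}" "g \<in> Lq_rel \<mu> q `` {g}"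
      using fs by (auto simp: Lq_rel_def)
    then have "\<forall>j\<in>multi_indices N. AE x in \<mu>. x \<in> cell y j \<longrightarrow>
        g x = f x + \<alpha> x * (g (Theta_inv N y v j x) - l (Theta_inv N y v j x))"
      using that unfolding self_referential_def by blast
    then have "AE x in \<mu>. \<forall>j\<in>multi_indices N. x \<in> cell y j \<longrightarrow>
        g x = f x + \<alpha> x * (g (Theta_inv N y v j x) - l (Theta_inv N y v j x))"
      using finite_multi_indices by (intro AE_finite_allI) auto
    with AE_space show ?E
    proof eventually_elim
      case (elim x)
      then obtain j where "j \<in> multi_indices N" "x \<in> cell y j"
        using net_box_covered space by blast
      then show ?case using elim piecewise_inv_cell by simp
    qed
  qed
  show ?S if ?E
    unfolding self_referential_def
  proof (intro ballI)
    fix f' l' g' j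
    assume "f' \<in> Lq_rel \<mu> q `` {f}" "l' \<in> Lq_rel \<mu> q `` {l}" "g' \<in> Lq_rel \<mu> q `` {g}"
      and j: "j \<in> multi_indices N"
    then have eqs: "AE x in \<mu>. f x = f' x" "AE x in \<mu>. l x = l' x" "AE x in \<mu>. g x = g' x"
      by (auto simp: Lq_rel_def)
    show "AE x in \<mu>. x \<in> cell y j \<longrightarrow>
        g' x = f' x + \<alpha> x * (g' (Theta_inv N y v j x) - l' (Theta_inv N y v j x))"
      using that eqs(1,3) AE_comp[OF eqs(2)] AE_comp[OF eqs(3)]
    proof eventually_elim
      case (elim x)
      then show ?case using piecewise_inv_cell[OF j, of x] by simp
    qed
  qed
qed

text \<open>Justifies the definite description in \<open>fractal_operator\<close> and replaces it by
  a representative satisfying the glued equation, which is all that the Lipschitz estimate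
  uses.\<close>

lemma fractal_operator_class:
  assumes inv: "invariant_prob N y v p \<mu>" and p: "(\<Sum>j\<in>multi_indices N. p j) = 1"
    and q: "1 \<le> q" and \<alpha> [measurable]: "\<alpha> \<in> borel_measurable \<mu>"
    and bound: "AE x in \<mu>. \<bar>\<alpha> x\<bar> \<le> c" and c: "0 < c" "c < 1"
    and f: "f \<in> Lq_funs \<mu> q" and l: "l \<in> Lq_funs \<mu> q" "L (Lq_rel \<mu> q `` {f}) = Lq_rel \<mu> q `` {l}"
  shows "\<exists>g\<in>Lq_funs \<mu> q. fractal_operator N y v \<mu> q \<alpha> L (Lq_rel \<mu> q `` {f}) = Lq_rel \<mu> q `` {g} \<and>
    (AE x in \<mu>. g x = f x + \<alpha> x * (g (piecewise_inv x) - l (piecewise_inv x)))"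
proof -
  interpret measure_preserving_map \<mu> piecewise_inv
    using inv p by (rule piecewise_inv_measure_preserving)
  let ?T = piecewise_inv
  note iff = self_referential_class_iff[OF inv p f l(1)]
  \<comment> \<open>Truncating \<open>\<alpha>\<close> to \<open>[-c, c]\<close> changes it only on
    a null set and provides the bound at every point that \<open>fixed_point_exists\<close> asks
    for.\<close>
  define a where "a x = max (- c) (min c (\<alpha> x))" for x
  have [measurable]: "a \<in> borel_measurable \<mu>" unfolding a_def by measurable
  have a: "\<bar>a x\<bar> \<le> c" for x using c by (auto simp: a_def)
  have a_eq: "AE x in \<mu>. a x = \<alpha> x" using bound by eventually_elim (auto simp: a_def)
  have "(\<lambda>x. a x * l (?T x)) \<in> Lq_funs \<mu> q"
    using a by (intro Lq_funs_bounded_mult[where c = c] Lq_funs_comp l q) auto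
  then have "(\<lambda>x. 1 * f x + (-1) * (a x * l (?T x))) \<in> Lq_funs \<mu> q"
    using q f by (intro Lq_funs_comb)
  from fixed_point_exists[OF this q \<open>a \<in> borel_measurable \<mu>\<close> a c] obtain g
    where g: "g \<in> Lq_funs \<mu> q"
      and "AE x in \<mu>. g x = 1 * f x + (-1) * (a x * l (?T x)) + a x * g (?T x)" by blast
  from this(2) a_eq have g_eq: "AE x in \<mu>. g x = f x + \<alpha> x * (g (?T x) - l (?T x))"
    by eventually_elim (simp add: algebra_simps)
  have "fractal_operator N y v \<mu> q \<alpha> L (Lq_rel \<mu> q `` {f}) = Lq_rel \<mu> q `` {g}"
    unfolding fractal_operator_def l(2)
  proof (rule the_equality)
    show "Lq_rel \<mu> q `` {g} \<in> Lq \<mu> q \<and>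
        self_referential N y v \<mu> \<alpha> (Lq_rel \<mu> q `` {f}) (Lq_rel \<mu> q `` {l}) (Lq_rel \<mu> q `` {g})"
      using g g_eq by (simp add: iff Lq_classI)
  next
    fix G assume G: "G \<in> Lq \<mu> q \<and>
      self_referential N y v \<mu> \<alpha> (Lq_rel \<mu> q `` {f}) (Lq_rel \<mu> q `` {l}) G"
    then obtain h where h: "h \<in> Lq_funs \<mu> q" "G = Lq_rel \<mu> q `` {h}" using Lq_cases by blast
    then have "AE x in \<mu>. h x = f x + \<alpha> x * (h (?T x) - l (?T x))" using G iff by blast
    \<comment> \<open>The zeros bring the difference of two solutions into the shape of
      \<open>fixed_point_estimate\<close> with vanishing \<open>u\<close> and \<open>l\<close>; the
      estimate then forces its \<open>q\<close>-th power to have integral 0.\<close>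
    with g_eq have eq: "AE x in \<mu>. h x - g x = 0 + \<alpha> x * ((h (?T x) - g (?T x)) - 0)"
      by eventually_elim (simp add: algebra_simps)
    have diff: "(\<lambda>x. h x - g x) \<in> Lq_funs \<mu> q" using Lq_funs_comb[OF q h(1) g, of 1 "-1"] by simp
    have zero: "(\<lambda>x. 0) \<in> Lq_funs \<mu> q" using q by (simp add: Lq_funs_def)
    have "(\<integral>x. \<bar>h x - g x\<bar> powr q \<partial>\<mu>) \<le> 0"
      using fixed_point_estimate[OF diff zero zero q bound c eq] q by simp
    then have "(\<integral>x. \<bar>h x - g x\<bar> powr q \<partial>\<mu>) = 0" by (simp add: antisym)
    moreover have "integrable \<mu> (\<lambda>x. \<bar>h x - g x\<bar> powr q)" using diff by (simp add: Lq_funs_def)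
    ultimately have "AE x in \<mu>. \<bar>h x - g x\<bar> powr q = 0"
      by (subst (asm) integral_nonneg_eq_0_iff_AE) auto
    then have "(h, g) \<in> Lq_rel \<mu> q" using h(1) g by (simp add: Lq_rel_def)
    then show "G = Lq_rel \<mu> q `` {g}"
      unfolding h(2) by (rule equiv_class_eq[OF equiv_Lq_rel])
  qed
  then show ?thesis using g g_eq by blast
qed

text \<open>Both Lipschitz constants are \<open>2 / (1 - c)\<close>. Subtracting the equations of
  two functions and applying \<open>fixed_point_estimate\<close> bounds the \<open>q\<close>-th
  power of the distance; taking the \<open>q\<close>-th root releases the constant, and
  \<open>powr_add_le\<close> separates the two distances.\<close>

lemma fractal_operator_relatively_Lipschitz:
  assumes inv: "invariant_prob N y v p \<mu>" and p: "(\<Sum>j\<in>multi_indices N. p j) = 1"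
    and q: "1 \<le> q" and L: "L \<in> Lq \<mu> q \<rightarrow> Lq \<mu> q"
    and \<alpha>: "\<alpha> \<in> borel_measurable \<mu>" "AE x in \<mu>. \<bar>\<alpha> x\<bar> \<le> c" and c: "0 < c" "c < 1"
  shows "Lq_relatively_Lipschitz \<mu> q (fractal_operator N y v \<mu> q \<alpha> L) L"
proof -
  interpret measure_preserving_map \<mu> piecewise_inv
    using inv p by (rule piecewise_inv_measure_preserving)
  let ?T = piecewise_inv and ?F = "fractal_operator N y v \<mu> q \<alpha> L"
  let ?K = "2 / (1 - c)"
  have rep: "\<exists>f l g. f \<in> Lq_funs \<mu> q \<and> l \<in> Lq_funs \<mu> q \<and> g \<in> Lq_funs \<mu> q \<and>
      X = Lq_rel \<mu> q `` {f} \<and> L X = Lq_rel \<mu> q `` {l} \<and> ?F X = Lq_rel \<mu> q `` {g} \<and>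
      (AE x in \<mu>. g x = f x + \<alpha> x * (g (?T x) - l (?T x)))" if X: "X \<in> Lq \<mu> q" for X
  proof -
    from X obtain f where f: "f \<in> Lq_funs \<mu> q" "X = Lq_rel \<mu> q `` {f}" by (rule Lq_cases)
    from X L have "L X \<in> Lq \<mu> q" by auto
    then obtain l where l: "l \<in> Lq_funs \<mu> q" "L X = Lq_rel \<mu> q `` {l}" by (rule Lq_cases)
    show ?thesis
      using fractal_operator_class[where L = L, OF inv p q \<alpha> c f(1) l(1)] f l by blast
  qed
  have "Lq_dist \<mu> q (?F X) (?F Y) \<le> ?K * Lq_dist \<mu> q X Y + ?K * Lq_dist \<mu> q (L X) (L Y)"
    if "X \<in> Lq \<mu> q" "Y \<in> Lq \<mu> q" for X Y
  proof -
    from rep[OF that(1)] obtain f1 l1 g1 where 1: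
      "f1 \<in> Lq_funs \<mu> q" "l1 \<in> Lq_funs \<mu> q" "g1 \<in> Lq_funs \<mu> q"
      "X = Lq_rel \<mu> q `` {f1}" "L X = Lq_rel \<mu> q `` {l1}" "?F X = Lq_rel \<mu> q `` {g1}"
      "AE x in \<mu>. g1 x = f1 x + \<alpha> x * (g1 (?T x) - l1 (?T x))" by blast
    from rep[OF that(2)] obtain f2 l2 g2 where 2:
      "f2 \<in> Lq_funs \<mu> q" "l2 \<in> Lq_funs \<mu> q" "g2 \<in> Lq_funs \<mu> q"
      "Y = Lq_rel \<mu> q `` {f2}" "L Y = Lq_rel \<mu> q `` {l2}" "?F Y = Lq_rel \<mu> q `` {g2}"
      "AE x in \<mu>. g2 x = f2 x + \<alpha> x * (g2 (?T x) - l2 (?T x))" by blast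
    have diff: "(\<lambda>x. r x - s x) \<in> Lq_funs \<mu> q" if "r \<in> Lq_funs \<mu> q" "s \<in> Lq_funs \<mu> q" for r s
      using Lq_funs_comb[OF q that, of 1 "-1"] by simp
    let ?I = "\<lambda>r s. \<integral>x. \<bar>r x - s x\<bar> powr q \<partial>\<mu>"
    from 1(7) 2(7) have "AE x in \<mu>. g1 x - g2 x = (f1 x - f2 x)
        + \<alpha> x * ((g1 (?T x) - g2 (?T x)) - (l1 (?T x) - l2 (?T x)))"
      by eventually_elim (simp add: algebra_simps)
    from fixed_point_estimate[OF diff[OF 1(3) 2(3)] diff[OF 1(1) 2(1)] diff[OF 1(2) 2(2)] q \<alpha>(2) c this]
    have "?I g1 g2 powr (1 / q) \<le> (?K powr q * (?I f1 f2 + ?I l1 l2)) powr (1 / q)"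
      using q by (intro powr_mono2) auto
    also have "\<dots> = ?K * (?I f1 f2 + ?I l1 l2) powr (1 / q)"
      using q c by (simp add: powr_mult powr_powr)
    also have "\<dots> \<le> ?K * (?I f1 f2 powr (1 / q) + ?I l1 l2 powr (1 / q))"
      using q c by (intro mult_left_mono powr_add_le) auto
    also have "?I g1 g2 powr (1 / q) = Lq_dist \<mu> q (?F X) (?F Y)"
      by (simp only: 1(6) 2(6) Lq_dist_class[OF q 1(3) 2(3)])
    also have "?I f1 f2 powr (1 / q) = Lq_dist \<mu> q X Y"
      by (simp only: 1(4) 2(4) Lq_dist_class[OF q 1(1) 2(1)])
    also have "?I l1 l2 powr (1 / q) = Lq_dist \<mu> q (L X) (L Y)"
      by (simp only: 1(5) 2(5) Lq_dist_class[OF q 1(2) 2(2)])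
    finally show ?thesis by (simp only: distrib_left)
  qed
  moreover have "?F \<in> Lq \<mu> q \<rightarrow> Lq \<mu> q"
  proof
    fix X assume "X \<in> Lq \<mu> q"
    from rep[OF this] show "?F X \<in> Lq \<mu> q" by (auto simp: Lq_classI)
  qed
  ultimately show ?thesis
    unfolding Lq_relatively_Lipschitz_def using L c
    by (intro conjI exI[of _ ?K]) auto
qed

end

text \<open>A real \<open>c\<close> fits strictly between the norm and \<open>r\<close>. Comparing
  with \<open>max 0 (Linf_norm M g)\<close> keeps \<open>c\<close> positive even if \<open>g\<close>
  vanishes almost everywhere; \<open>fixed_point_exists\<close> divides by it.\<close>

lemma Linf_norm_less_bound:
  assumes "Linf_norm M g < ereal r" "0 < r"
  obtains c where "0 < c" "c < r" "AE x in M. \<bar>g x\<bar> \<le> c"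
proof -
  have "max 0 (Linf_norm M g) < ereal r" using assms by simp
  then obtain c where c: "max 0 (Linf_norm M g) < ereal c" "ereal c < ereal r"
    using ereal_dense2 by blast
  have "AE x in M. ereal \<bar>g x\<bar> \<le> Linf_norm M g"
    unfolding Linf_norm_def by (rule esssup_AE)
  then have "AE x in M. \<bar>g x\<bar> \<le> c"
  proof eventually_elim
    case (elim x)
    note elim
    also have "Linf_norm M g < ereal c" using c(1) by simp
    finally have "ereal \<bar>g x\<bar> < ereal c" .
    then show ?case by simp
  qed
  then show thesis using c that[of c] by auto
qed

theorem theorem3p4:
  fixes N :: "'n::finite \<Rightarrow> nat"
    and y :: "'n \<Rightarrow> nat \<Rightarrow> real"
    and v :: "'n \<Rightarrow> nat \<Rightarrow> real \<Rightarrow> real"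
    and \<gamma> :: "'n \<Rightarrow> nat \<Rightarrow> real"
    and p :: "('n \<Rightarrow> nat) \<Rightarrow> real"
    and \<mu> :: "(real ^ 'n) measure"
    and q :: real
    and L :: "(real ^ 'n \<Rightarrow> real) set \<Rightarrow> (real ^ 'n \<Rightarrow> real) set"
    and \<alpha> :: "real ^ 'n \<Rightarrow> real"
  assumes "CARD('n) \<ge> 2"
    and "\<And>k. 1 \<le> N k"
    and "\<And>k. strict_mono_on {0..N k} (y k)"
    and "\<And>k i. i \<in> {1..N k} \<Longrightarrow>
           \<exists>w. homeomorphism (axis_interval N y k) (axis_subinterval y k i) (v k i) w"
    and "\<And>k i. i \<in> {1..N k} \<Longrightarrow> 0 < \<gamma> k i \<and> \<gamma> k i < 1"
    and "\<And>k i z z'. i \<in> {1..N k} \<Longrightarrow> z \<in> axis_interval N y k \<Longrightarrow> z' \<in> axis_interval N y k \<Longrightarrow>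
           \<bar>v k i z - v k i z'\<bar> \<le> \<gamma> k i * \<bar>z - z'\<bar>"
    and "\<And>k i. i \<in> {1..N k} \<Longrightarrow> odd i \<Longrightarrow>
           v k i (y k 0) = y k (i - 1) \<and> v k i (y k (N k)) = y k i"
    and "\<And>k i. i \<in> {1..N k} \<Longrightarrow> even i \<Longrightarrow>
           v k i (y k 0) = y k i \<and> v k i (y k (N k)) = y k (i - 1)"
    and "\<And>j. j \<in> multi_indices N \<Longrightarrow> 0 < p j"
    and "(\<Sum>j\<in>multi_indices N. p j) = 1"
    and "invariant_prob N y v p \<mu>"
    and "1 \<le> q"
    and "L \<in> Lq \<mu> q \<rightarrow> Lq \<mu> q"
    and "Lq_affine \<mu> q L"
    and "Lq_bounded_map \<mu> q L"
    and "\<alpha> \<in> Linf_funs \<mu>"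
    and "Linf_norm \<mu> \<alpha> < 1"
  shows "Lq_relatively_Lipschitz \<mu> q (fractal_operator N y v \<mu> q \<alpha> L) L"
proof -
  interpret alternating_net N y v
    using assms(2-4,7,8) by unfold_locales
  have "Linf_norm \<mu> \<alpha> < ereal 1" using assms(17) by (simp add: one_ereal_def)
  then obtain c where c: "0 < c" "c < 1" "AE x in \<mu>. \<bar>\<alpha> x\<bar> \<le> c"
    by (rule Linf_norm_less_bound) simp
  show ?thesis
    using assms(11,10,12,13) _ c(3,1,2)
    by (rule fractal_operator_relatively_Lipschitz) (use assms(16) in \<open>simp add: Linf_funs_def\<close>)
qed

end
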